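(* Let $F$ be the free group on a countably infinite set of generators $f_1,f_2,f_3,\dots$, and let $G$ be the group with generators $f_1,f_2,\dots$ and relations $f_kf_{k-1}f_kf_{k-1}f_kf_{k-1}=e$ for all integers $k\ge 2$ (i.e. the quotient of $F$ by the normal subgroup generated by these words). Let $\mathcal{A}$ be the complex group algebra of $G$, with adjoint $\left(\sum_{g}a_g g\right)^*=\sum_g\overline{a_g}\,g^{-1}$ and expectation $E\left(\sum_{g}a_g g\right)=a_e$. Put $X_i=f_i+f_i^{-1}\in\mathcal{A}$ for $i\ge 1$. Then the sequence of random variables $\{X_i\}_{i\ge1}$ is not free but satisfies Condition A.
   Context: $\mathcal{A}$ acts on $L^2(G)$ (square-summable functions on $G$ for the counting measure) by extending linearly the translations $(L_gx)(h)=x(gh)$; equivalently to the formula above, $E(h)=\langle\delta_e,L_h\delta_e\rangle$. The functional $E$ is positive, tracial and satisfies $E(e)=1$, and the unit is $I=e$. Freeness: subalgebras $\mathcal{A}_1,\dots,\mathcal{A}_n$ of $\mathcal{A}$ are free if $E(a_1\cdots a_m)=0$ whenever $a_i\in\mathcal{A}_{k(i)}$, $E(a_i)=0$ for every $i$, and $k(i)\ne k(i+1)$ for every $i<m$. Variables $X_1,\dots,X_n$ are free if the algebras $\mathcal{A}_i$ generated by $\{I,X_i,X_i^*\}$ are free; an infinite sequence is free if every finite subfamily is free. Condition A: a sequence of zero-mean random variables $X_1,X_2,\dots$ (i.e. $E(X_i)=0$ for all $i$) satisfies Condition A if: 1. For every $k$, $E(X_kX_{i_1}\cdots X_{i_r})=0$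 whenever $i_s\ne k$ for $s=1,\dots,r$. 2. For every $k\ge 2$, $E(X_k^2X_{i_1}\cdots X_{i_r})=E(X_k^2)\,E(X_{i_1}\cdots X_{i_r})$ whenever $i_s<k$ for $s=1,\dots,r$. 3. For every $k\ge 2$, $E(X_kX_{i_1}\cdots X_{i_p}X_kX_{i_{p+1}}\cdots X_{i_r})=E(X_k^2)\,E(X_{i_1}\cdots X_{i_p})\,E(X_{i_{p+1}}\cdots X_{i_r})$ whenever $i_s<k$ for $s=1,\dots,r$. (Indices may repeat; empty products equal $I$.) *)

theory Defs
  imports Complex_Main "HOL.Hull" "HOL-Library.Poly_Mapping"
begin

text \<open>
  The type class of (not necessarily abelian) groups is \<^class>\<open>group_add\<close>, so every group below is
  written additively: \<open>+\<close> is the group multiplication, \<open>0\<close> the neutral element and \<open>- g\<close> the inverse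
  of \<open>g\<close>.  The group algebra over the complex numbers is then \<^typ>\<open>'g \<Rightarrow>\<^sub>0 complex\<close> with its
  convolution product; \<open>g\<close> is embedded as \<open>Poly_Mapping.single g 1\<close>.
\<close>


section \<open>Free groups\<close>

text \<open>
  The letter \<open>(True, x)\<close> is the generator \<open>x\<close>, the letter \<open>(False, x)\<close> its inverse.
\<close>

inductive cancels :: "(bool \<times> 'a) list \<Rightarrow> (bool \<times> 'a) list \<Rightarrow> bool" where
  "cancels (u @ [(b, x), (\<not> b, x)] @ v) (u @ v)"

definition inv_word :: "(bool \<times> 'a) list \<Rightarrow> (bool \<times> 'a) list" where
  "inv_word w = rev (map (\<lambda>(b, x). (\<not> b, x)) w)"

lemma equivclp_map:
  assumes "\<And>x y. r x y \<Longrightarrow> equivclp s (h x) (h y)" and "equivclp r x y"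
  shows "equivclp s (h x) (h y)"
  using assms(2)
proof (induction rule: equivclp_induct)
  case base
  then show ?case by simp
next
  case (step y z)
  from step(2) have "equivclp s (h y) (h z)"
    using assms(1) equivclp_sym by metis
  with step(3) show ?case by (rule equivclp_trans)
qed

lemma cancels_append_left: "cancels u u' \<Longrightarrow> cancels (u @ w) (u' @ w)"
proof (induction rule: cancels.induct)
  case (1 u b x v)
  show ?case using cancels.intros[of u b x "v @ w"] by simp
qed

lemma cancels_append_right: "cancels v v' \<Longrightarrow> cancels (w @ v) (w @ v')"
proof (induction rule: cancels.induct)
  case (1 u b x v)
  show ?case using cancels.intros[of "w @ u" b x v] by simp
qed

lemma equivclp_cancels_append:
  assumes "equivclp cancels u u'" "equivclp cancels v v'"
  shows "equivclp cancels (u @ v) (u' @ v')"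
proof -
  have "equivclp cancels (u @ v) (u' @ v)"
    by (rule equivclp_map[where h = "\<lambda>w. w @ v", OF _ assms(1)]) (rule r_into_equivclp, rule cancels_append_left)
  moreover have "equivclp cancels (u' @ v) (u' @ v')"
    by (rule equivclp_map[where h = "\<lambda>w. u' @ w", OF _ assms(2)]) (rule r_into_equivclp, rule cancels_append_right)
  ultimately show ?thesis by (rule equivclp_trans)
qed

lemma cancels_inv_word: "cancels u u' \<Longrightarrow> cancels (inv_word u) (inv_word u')"
proof (induction rule: cancels.induct)
  case (1 u b x v)
  show ?case
    using cancels.intros[of "inv_word v" b x "inv_word u"] by (simp add: inv_word_def)
qed

lemma equivclp_cancels_inv_word:
  "equivclp cancels u u' \<Longrightarrow> equivclp cancels (inv_word u) (inv_word u')"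
  by (rule equivclp_map[where h = inv_word]) (rule r_into_equivclp, rule cancels_inv_word)

lemma inv_word_append: "equivclp cancels (inv_word w @ w) []"
proof (induction w)
  case Nil
  then show ?case by (simp add: inv_word_def)
next
  case (Cons l w)
  obtain b x where l: "l = (b, x)" by fastforce
  have "cancels (inv_word (l # w) @ l # w) (inv_word w @ w)"
    using cancels.intros[of "inv_word w" "\<not> b" x w] by (simp add: inv_word_def l)
  from equivclp_trans[OF r_into_equivclp[where r = cancels, OF this] Cons.IH] show ?case .
qed

quotient_type 'a free_group = "(bool \<times> 'a) list" / "equivclp cancels"
  by (rule equivp_evquivclp)

instantiation free_group :: (type) group_add
begin

lift_definition zero_free_group :: "'a free_group" is "[]" .

lift_definition plus_free_group :: "'a free_group \<Rightarrow> 'a free_group \<Rightarrow> 'a free_group" is "(@)"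
  by (rule equivclp_cancels_append)

lift_definition uminus_free_group :: "'a free_group \<Rightarrow> 'a free_group" is inv_word
  by (rule equivclp_cancels_inv_word)

definition minus_free_group :: "'a free_group \<Rightarrow> 'a free_group \<Rightarrow> 'a free_group" where
  "minus_free_group x y = x + - y"

instance
  by intro_classes
    (transfer; simp add: inv_word_append; fail | simp add: minus_free_group_def)+

end

lift_definition free_gen :: "'a \<Rightarrow> 'a free_group" is "\<lambda>x. [(True, x)]" .


section \<open>The group with relations \<open>(f\<^sub>k f\<^sub>k\<^sub>-\<^sub>1)\<^sup>3 = e\<close>, \<open>k \<ge> 2\<close>\<close>

definition normal_subgroup :: "'g::group_add set \<Rightarrow> bool" where
  "normal_subgroup N \<longleftrightarrow>
     0 \<in> N \<and> (\<forall>x\<in>N. \<forall>y\<in>N. x + y \<in> N) \<and> (\<forall>x\<in>N. - x \<in> N) \<and> (\<forall>g. \<forall>x\<in>N. g + x + - g \<in> N)"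

lemma normal_subgroup_hull: "normal_subgroup (normal_subgroup hull S)"
  by (rule hull_in) (auto simp: normal_subgroup_def)

text \<open>
  The generators \<open>f\<^sub>1, f\<^sub>2, \<dots>\<close> are numbered from 1, so \<open>f\<^sub>k\<close> is the basis element \<open>k - 1\<close> of the free
  group on \<^typ>\<open>nat\<close>.  The value at \<open>k = 0\<close> is never used.
\<close>

definition F_gen :: "nat \<Rightarrow> nat free_group" where
  "F_gen k = free_gen (k - 1)"

definition relators :: "nat free_group set" where
  "relators = {F_gen k + F_gen (k - 1) + F_gen k + F_gen (k - 1) + F_gen k + F_gen (k - 1) | k. k \<ge> 2}"

definition same_coset :: "nat free_group \<Rightarrow> nat free_group \<Rightarrow> bool" where
  "same_coset x y \<longleftrightarrow> - x + y \<in> normal_subgroup hull relators"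

lemma same_coset_add:
  assumes "same_coset x x'" "same_coset y y'"
  shows "same_coset (x + y) (x' + y')"
proof -
  let ?N = "normal_subgroup hull relators"
  have N: "normal_subgroup ?N" by (rule normal_subgroup_hull)
  have "- y + (- x + x') + - (- y) \<in> ?N"
    using N assms(1) unfolding normal_subgroup_def same_coset_def by blast
  then have "(- y + (- x + x') + - (- y)) + (- y + y') \<in> ?N"
    using N assms(2) unfolding normal_subgroup_def same_coset_def by blast
  moreover have "(- y + (- x + x') + - (- y)) + (- y + y') = - (x + y) + (x' + y')"
    by (simp add: minus_add add.assoc del: add_uminus_conv_diff)
  ultimately show ?thesis by (simp only: same_coset_def)
qed

lemma same_coset_uminus:
  assumes "same_coset x y"
  shows "same_coset (- x) (- y)"
proof -
  let ?N = "normal_subgroup hull relators"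
  have N: "normal_subgroup ?N" by (rule normal_subgroup_hull)
  have "- (x + (- x + y) + - x) \<in> ?N"
    using N assms unfolding normal_subgroup_def same_coset_def by blast
  moreover have "- (x + (- x + y) + - x) = - (- x) + - y"
    by (simp add: minus_add add.assoc del: add_uminus_conv_diff)
  ultimately show ?thesis by (simp only: same_coset_def)
qed

lemma equivp_same_coset: "equivp same_coset"
proof (rule equivpI)
  let ?N = "normal_subgroup hull relators"
  have N: "normal_subgroup ?N" by (rule normal_subgroup_hull)
  show "reflp same_coset"
    using N by (auto simp: reflp_def same_coset_def normal_subgroup_def)
  show "symp same_coset"
  proof (rule sympI)
    fix x y assume "same_coset x y"
    then have "- (- x + y) \<in> ?N"
      using N unfolding normal_subgroup_def same_coset_def by blast
    then show "same_coset y x"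
      by (simp add: same_coset_def minus_add del: add_uminus_conv_diff)
  qed
  show "transp same_coset"
  proof (rule transpI)
    fix x y z assume "same_coset x y" "same_coset y z"
    then have "(- x + y) + (- y + z) \<in> ?N"
      using N unfolding normal_subgroup_def same_coset_def by blast
    then show "same_coset x z"
      by (simp add: same_coset_def add.assoc del: add_uminus_conv_diff)
  qed
qed

quotient_type G = "nat free_group" / same_coset
  by (rule equivp_same_coset)

instantiation G :: group_add
begin

lift_definition zero_G :: G is 0 .

lift_definition plus_G :: "G \<Rightarrow> G \<Rightarrow> G" is "(+)"
  by (rule same_coset_add)

lift_definition uminus_G :: "G \<Rightarrow> G" is uminus
  by (rule same_coset_uminus)

definition minus_G :: "G \<Rightarrow> G \<Rightarrow> G" where
  "minus_G x y = x + - y"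

instance
proof
  have refl: "same_coset x x" for x
    using equivp_same_coset by (rule equivp_reflp)
  fix a b c :: G
  show "a + b + c = a + (b + c)" by transfer (simp add: add.assoc refl)
  show "0 + a = a" by transfer (simp add: refl)
  show "a + 0 = a" by transfer (simp add: refl)
  show "- a + a = 0" by transfer (simp add: refl)
  show "a + - b = a - b" by (simp add: minus_G_def)
qed

end

lift_definition G_gen :: "nat \<Rightarrow> G" is F_gen .


section \<open>Random variables in a group algebra\<close>

definition adj :: "('g::group_add \<Rightarrow>\<^sub>0 complex) \<Rightarrow> ('g \<Rightarrow>\<^sub>0 complex)" where
  "adj a = (\<Sum>g \<in> Poly_Mapping.keys a. Poly_Mapping.single (- g) (cnj (Poly_Mapping.lookup a g)))"

definition expec :: "('g::group_add \<Rightarrow>\<^sub>0 complex) \<Rightarrow> complex" where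
  "expec a = Poly_Mapping.lookup a 0"

definition subalgebra :: "('g::group_add \<Rightarrow>\<^sub>0 complex) set \<Rightarrow> bool" where
  "subalgebra S \<longleftrightarrow>
     0 \<in> S \<and> (\<forall>a\<in>S. \<forall>b\<in>S. a + b \<in> S) \<and> (\<forall>a\<in>S. \<forall>b\<in>S. a * b \<in> S) \<and>
     (\<forall>c. \<forall>a\<in>S. Poly_Mapping.map ((*) c) a \<in> S)"

definition free_subalgebras :: "nat set \<Rightarrow> (nat \<Rightarrow> ('g::group_add \<Rightarrow>\<^sub>0 complex) set) \<Rightarrow> bool" where
  "free_subalgebras J A \<longleftrightarrow>
     (\<forall>m\<ge>1. \<forall>(k :: nat \<Rightarrow> nat) (a :: nat \<Rightarrow> ('g \<Rightarrow>\<^sub>0 complex)).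
        (\<forall>i\<in>{1..m}. k i \<in> J \<and> a i \<in> A (k i) \<and> expec (a i) = 0) \<longrightarrow>
        (\<forall>i\<in>{1..<m}. k i \<noteq> k (i + 1)) \<longrightarrow>
        expec (prod_list (map a [1..<m + 1])) = 0)"

definition free_variables :: "nat set \<Rightarrow> (nat \<Rightarrow> ('g::group_add \<Rightarrow>\<^sub>0 complex)) \<Rightarrow> bool" where
  "free_variables J X \<longleftrightarrow> free_subalgebras J (\<lambda>i. subalgebra hull {1, X i, adj (X i)})"

text \<open>A sequence \<open>X\<^sub>1, X\<^sub>2, \<dots>\<close> is a function on \<^typ>\<open>nat\<close> whose value at 0 is ignored.\<close>

definition free_sequence :: "(nat \<Rightarrow> ('g::group_add \<Rightarrow>\<^sub>0 complex)) \<Rightarrow> bool" where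
  "free_sequence X \<longleftrightarrow> (\<forall>J. finite J \<and> J \<subseteq> {1..} \<longrightarrow> free_variables J X)"

definition condition_A :: "(nat \<Rightarrow> ('g::group_add \<Rightarrow>\<^sub>0 complex)) \<Rightarrow> bool" where
  "condition_A X \<longleftrightarrow>
     (\<forall>i\<ge>1. expec (X i) = 0) \<and>
     (\<forall>k\<ge>1. \<forall>is. set is \<subseteq> {1..} - {k} \<longrightarrow>
        expec (X k * prod_list (map X is)) = 0) \<and>
     (\<forall>k\<ge>2. \<forall>is. set is \<subseteq> {1..<k} \<longrightarrow>
        expec ((X k)\<^sup>2 * prod_list (map X is)) = expec ((X k)\<^sup>2) * expec (prod_list (map X is))) \<and>
     (\<forall>k\<ge>2. \<forall>is js. set is \<subseteq> {1..<k} \<and> set js \<subseteq> {1..<k} \<longrightarrow>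
        expec (X k * prod_list (map X is) * X k * prod_list (map X js)) =
        expec ((X k)\<^sup>2) * expec (prod_list (map X is)) * expec (prod_list (map X js)))"

definition X_var :: "nat \<Rightarrow> (G \<Rightarrow>\<^sub>0 complex)" where
  "X_var i = Poly_Mapping.single (G_gen i) 1 + Poly_Mapping.single (- G_gen i) 1"

end

theory Submission
  imports Defs
begin

text \<open>
  Every element \<open>f\<^sub>k\<close> is separated from the other generators by a homomorphism to a permutation group
  that sends it to a 3-cycle and the others to the identity.  This settles all parts of Condition A
  except the following one: if \<open>u\<close>, \<open>v\<close> are words in \<open>f\<^sub>1, \<dots>, f\<^sub>k\<^sub>-\<^sub>1\<close> and \<open>f\<^sub>k u f\<^sub>k\<^sup>-\<^sup>1 v = e\<close>, then
  \<open>u = e\<close>.  The relations only say that \<open>t = f\<^sub>k f\<^sub>k\<^sub>-\<^sub>1\<close> has order 3, so \<open>G\<close> acts on \<open>G\<close> with two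
  extra points \<open>a\<close>, \<open>b\<close>, where \<open>f\<^sub>i\<close> with \<open>i < k\<close> acts by left translation on \<open>G\<close> and fixes
  \<open>a\<close>, \<open>b\<close>, while \<open>t\<close> acts as the 3-cycle \<open>e \<rightarrow> a \<rightarrow> b \<rightarrow> e\<close>; evaluating \<open>f\<^sub>k u f\<^sub>k\<^sup>-\<^sup>1\<close> at \<open>a\<close> gives
  the claim.  Freeness fails because it would force \<open>E(X\<^sub>2X\<^sub>1X\<^sub>2X\<^sub>1X\<^sub>2X\<^sub>1) = 0\<close>, whereas this sum of
  nonnegative terms contains the contribution 1 of \<open>(f\<^sub>2 f\<^sub>1)\<^sup>3 = e\<close>.
\<close>


section \<open>Actions of \<open>G\<close> from its presentation\<close>

definition word_act :: "('a \<Rightarrow> 's \<Rightarrow> 's) \<Rightarrow> (bool \<times> 'a) list \<Rightarrow> 's \<Rightarrow> 's" where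
  "word_act p = foldr (\<lambda>(b, x). if b then p x else inv (p x))"

lemma word_act_Nil [simp]: "word_act p [] = id"
  by (auto simp: word_act_def)

lemma word_act_append [simp]: "word_act p (u @ v) = word_act p u \<circ> word_act p v"
  by (simp add: word_act_def fun_eq_iff)

lemma word_act_cancels:
  assumes "\<And>i. bij (p i)" and "cancels u v"
  shows "word_act p u = word_act p v"
  using assms(2)
proof cases
  case (1 u' b x v')
  have "word_act p [(b, x), (\<not> b, x)] = id"
    using assms(1)[of x] by (auto simp: word_act_def fun_eq_iff bij_def surj_f_inv_f)
  then have "word_act p (u' @ [(b, x), (\<not> b, x)] @ v') = word_act p (u' @ v')"
    by (simp only: word_act_append id_comp)
  then show ?thesis
    unfolding 1 .
qed

lemma word_act_equivclp:
  assumes "\<And>i. bij (p i)" and "equivclp cancels u v"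
  shows "word_act p u = word_act p v"
  using assms(2)
proof (induction rule: equivclp_induct)
  case (step y z)
  from step(2) have "word_act p y = word_act p z"
    using word_act_cancels[OF assms(1)] by fastforce
  with step(3) show ?case by simp
qed simp

text \<open>A letter and its inverse cancel only for bijections. The default \<open>id\<close> keeps
  \<open>free_act p\<close> a homomorphism for every \<open>p\<close>, so the laws for
  \<open>0\<close> and \<open>+\<close> carry no hypothesis.\<close>

lift_definition free_act :: "('a \<Rightarrow> 's \<Rightarrow> 's) \<Rightarrow> 'a free_group \<Rightarrow> 's \<Rightarrow> 's" is
  "\<lambda>p w. if \<forall>i. bij (p i) then word_act p w else id"
  using word_act_equivclp by fastforce

lemma free_act_zero [simp]: "free_act p 0 = id"
  by transfer simp

lemma free_act_add [simp]: "free_act p (x + y) = free_act p x \<circ> free_act p y"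
  by transfer simp

lemma free_act_gen: "(\<And>i. bij (p i)) \<Longrightarrow> free_act p (free_gen i) = p i"
  by transfer (simp add: word_act_def)

lemma normal_subgroup_free_act_kernel: "normal_subgroup {x. free_act p x = id}"
proof -
  have "free_act p (- x) = id" if "free_act p x = id" for x
    using free_act_add[of p "- x" x] that by simp
  moreover have "free_act p (g + x + - g) = id" if "free_act p x = id" for g x
    using free_act_add[of p g "- g"] that by (simp del: add_uminus_conv_diff)
  ultimately show ?thesis
    by (simp add: normal_subgroup_def del: add_uminus_conv_diff)
qed

text \<open>Indices are those of the free basis: \<open>p i\<close> is the image of
  \<open>G_gen (Suc i)\<close>, and the second clause is the relator for
  \<open>k = i + 2\<close>.\<close>

definition respects_relators :: "(nat \<Rightarrow> 's \<Rightarrow> 's) \<Rightarrow> bool" where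
  "respects_relators p \<longleftrightarrow> (\<forall>i. bij (p i)) \<and> (\<forall>i. (p (Suc i) \<circ> p i) ^^ 3 = id)"

text \<open>The kernel of the action is normal and contains the relators, hence also their normal
  closure.\<close>

lemma free_act_same_coset:
  assumes "respects_relators p" and "same_coset x y"
  shows "free_act p x = free_act p y"
proof -
  have bij: "\<And>i. bij (p i)" and rel: "\<And>i. (p (Suc i) \<circ> p i) ^^ 3 = id"
    using assms(1) by (auto simp: respects_relators_def)
  have "free_act p (F_gen k + F_gen (k - 1) + F_gen k + F_gen (k - 1) + F_gen k + F_gen (k - 1)) = id"
    if "k \<ge> 2" for k
  proof -
    have "Suc (k - 2) = k - 1" using that by simp
    then have "p (k - 1) \<circ> p (k - 2) \<circ> (p (k - 1) \<circ> p (k - 2)) \<circ> (p (k - 1) \<circ> p (k - 2)) = id"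
      using rel[of "k - 2"] by (simp add: numeral_3_eq_3 comp_assoc)
    moreover have "k - 1 - 1 = k - 2" by simp
    ultimately show ?thesis
      by (simp only: F_gen_def free_act_add free_act_gen[OF bij] comp_assoc)
  qed
  then have "relators \<subseteq> {x. free_act p x = id}"
    unfolding relators_def by blast
  then have "normal_subgroup hull relators \<subseteq> {x. free_act p x = id}"
    using normal_subgroup_free_act_kernel by (rule hull_minimal)
  then have "free_act p (- x + y) = id"
    using assms(2) unfolding same_coset_def by blast
  then show ?thesis
    using free_act_add[of p x "- x + y"] by (simp del: free_act_add)
qed

lift_definition G_act :: "(nat \<Rightarrow> 's \<Rightarrow> 's) \<Rightarrow> G \<Rightarrow> 's \<Rightarrow> 's" is
  "\<lambda>p x. if respects_relators p then free_act p x else id"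
  by (auto dest: free_act_same_coset)

lemma G_act_zero [simp]: "G_act p 0 = id"
  by transfer simp

lemma G_act_add [simp]: "G_act p (x + y) = G_act p x \<circ> G_act p y"
  by transfer simp

lemma G_act_gen: "respects_relators p \<Longrightarrow> G_act p (G_gen i) = p (i - 1)"
  by transfer (simp add: F_gen_def free_act_gen respects_relators_def)

lemma G_act_uminus_cancel [simp]: "G_act p (- g) (G_act p g x) = x" "G_act p g (G_act p (- g) x) = x"
  using G_act_add[of p "- g" g] G_act_add[of p g "- g"]
  by (simp_all add: fun_eq_iff del: G_act_add)

lemma G_gen_relation:
  assumes "k \<ge> 2"
  shows "G_gen k + G_gen (k - 1) + G_gen k + G_gen (k - 1) + G_gen k + G_gen (k - 1) = 0"
proof -
  let ?r = "F_gen k + F_gen (k - 1) + F_gen k + F_gen (k - 1) + F_gen k + F_gen (k - 1)"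
  have "?r \<in> relators" using assms by (auto simp: relators_def)
  then have "- ?r \<in> normal_subgroup hull relators"
    using normal_subgroup_hull[of relators] hull_inc[of ?r relators normal_subgroup]
    unfolding normal_subgroup_def by blast
  then have "same_coset ?r 0" by (simp add: same_coset_def)
  then show ?thesis by transfer
qed


section \<open>Separating the generators\<close>

definition cycle3 :: "'s \<Rightarrow> 's \<Rightarrow> 's \<Rightarrow> 's \<Rightarrow> 's" where
  "cycle3 a b c = (\<lambda>x. if x = a then b else if x = b then c else if x = c then a else x)"

lemma cycle3_cubed: "distinct [a, b, c] \<Longrightarrow> cycle3 a b c ^^ 3 = id"
  by (auto simp: cycle3_def eval_nat_numeral)

lemma bij_cycle3:
  assumes "distinct [a, b, c]"
  shows "bij (cycle3 a b c)"
proof (rule o_bij)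
  show "(cycle3 a b c ^^ 2) \<circ> cycle3 a b c = id" "cycle3 a b c \<circ> (cycle3 a b c ^^ 2) = id"
    using cycle3_cubed[OF assms] by (simp_all add: eval_nat_numeral o_assoc)
qed

text \<open>Order 3 serves twice: every relator acts as the cube of a 3-cycle or of
  \<open>id\<close>, and the square of the isolated generator still acts nontrivially.\<close>

definition isolating_act :: "nat \<Rightarrow> G \<Rightarrow> nat \<Rightarrow> nat" where
  "isolating_act k = G_act (\<lambda>i. if i = k - 1 then cycle3 0 1 2 else id)"

lemma isolating_act_gen:
  "isolating_act k (G_gen i) = (if i - 1 = k - 1 then cycle3 0 1 2 else id)"
proof -
  have "respects_relators (\<lambda>i. if i = k - 1 then cycle3 0 1 (2::nat) else id)"
    by (auto simp: respects_relators_def bij_cycle3 cycle3_cubed)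
  then show ?thesis
    by (simp add: isolating_act_def G_act_gen)
qed

definition isolated_kernel :: "nat \<Rightarrow> G set" where
  "isolated_kernel k = {g. isolating_act k g = id}"

lemma isolating_act_add: "isolating_act k (x + y) = isolating_act k x \<circ> isolating_act k y"
  by (simp add: isolating_act_def)

lemma isolating_act_uminus: "isolating_act k (- x) = inv (isolating_act k x)"
  by (rule inv_unique_comp[symmetric]) (auto simp: isolating_act_def)

lemma zero_in_isolated_kernel: "0 \<in> isolated_kernel k"
  by (simp add: isolated_kernel_def isolating_act_def)

lemma add_in_isolated_kernel:
  "x \<in> isolated_kernel k \<Longrightarrow> y \<in> isolated_kernel k \<Longrightarrow> x + y \<in> isolated_kernel k"
  by (simp add: isolated_kernel_def isolating_act_add)

lemma uminus_in_isolated_kernel_iff [simp]: "- x \<in> isolated_kernel k \<longleftrightarrow> x \<in> isolated_kernel k"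
proof -
  have "- x \<in> isolated_kernel k" if "x \<in> isolated_kernel k" for x
    using that by (simp add: isolated_kernel_def isolating_act_uminus)
  from this[of x] this[of "- x"] show ?thesis by auto
qed

text \<open>Truncated subtraction identifies \<open>G_gen 0\<close> with \<open>G_gen 1\<close>,
  hence the lower bounds.\<close>

lemma gen_in_isolated_kernel:
  "i \<ge> 1 \<Longrightarrow> k \<ge> 1 \<Longrightarrow> i \<noteq> k \<Longrightarrow> G_gen i \<in> isolated_kernel k"
  by (auto simp: isolated_kernel_def isolating_act_gen)

lemma gen_notin_isolated_kernel:
  "G_gen k \<notin> isolated_kernel k" "G_gen k + G_gen k \<notin> isolated_kernel k"
  "- G_gen k \<notin> isolated_kernel k" "- G_gen k - G_gen k \<notin> isolated_kernel k"
proof -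
  show 1: "G_gen k \<notin> isolated_kernel k" "G_gen k + G_gen k \<notin> isolated_kernel k"
    by (auto simp: isolated_kernel_def isolating_act_gen isolating_act_add cycle3_def fun_eq_iff
        intro!: exI[of _ 0])
  have "- (G_gen k + G_gen k) \<notin> isolated_kernel k"
    using 1(2) by simp
  then show "- G_gen k \<notin> isolated_kernel k" "- G_gen k - G_gen k \<notin> isolated_kernel k"
    using 1(1) by (simp_all add: minus_add)
qed

lemma conj_in_isolated_kernel_iff:
  assumes "u \<in> isolated_kernel k"
  shows "x + u + y \<in> isolated_kernel k \<longleftrightarrow> x + y \<in> isolated_kernel k"
  using assms by (simp add: isolated_kernel_def isolating_act_add)

section \<open>The action on the group with two extra points\<close>

definition translation :: "G \<Rightarrow> G + bool \<Rightarrow> G + bool" where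
  "translation g = map_sum ((+) g) id"

definition tri :: "G + bool \<Rightarrow> G + bool" where
  "tri = cycle3 (Inl 0) (Inr False) (Inr True)"

text \<open>
  From \<open>f\<^sub>k\<close> on, the generators act alternately as \<open>T f\<^sub>k\<^sub>-\<^sub>1\<^sup>-\<^sup>1\<close> and its inverse, where \<open>T\<close> is the
  3-cycle, so that all later relators act trivially.  Generator \<open>f\<^sub>i\<close> has index \<open>i - 1\<close>, hence
  \<open>f\<^sub>k\<^sub>-\<^sub>1\<close> and \<open>f\<^sub>k\<close> have indices \<open>m\<close> and \<open>m + 1\<close>.
\<close>

fun amalgam_perm :: "nat \<Rightarrow> nat \<Rightarrow> G + bool \<Rightarrow> G + bool" where
  "amalgam_perm m i =
     (if i \<le> m then translation (G_gen (Suc i))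
      else if i = Suc m then tri \<circ> translation (- G_gen (Suc m))
      else inv (amalgam_perm m (i - 1)))"

declare amalgam_perm.simps [simp del]

lemma amalgam_perm_le: "i \<le> m \<Longrightarrow> amalgam_perm m i = translation (G_gen (Suc i))"
  by (subst amalgam_perm.simps) simp

lemma amalgam_perm_Suc: "amalgam_perm m (Suc m) = tri \<circ> translation (- G_gen (Suc m))"
  by (subst amalgam_perm.simps) simp

lemma amalgam_perm_gt: "m < i \<Longrightarrow> amalgam_perm m (Suc i) = inv (amalgam_perm m i)"
  by (subst amalgam_perm.simps) simp

lemma translation_comp [simp]: "translation g \<circ> translation h = translation (g + h)"
proof
  fix x
  show "(translation g \<circ> translation h) x = translation (g + h) x"
    by (cases x) (simp_all add: translation_def add.assoc)
qed

lemma translation_zero [simp]: "translation 0 = id"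
proof
  fix x show "translation 0 x = id x"
    by (cases x) (simp_all add: translation_def)
qed

lemma bij_translation: "bij (translation g)"
  by (rule o_bij[where g = "translation (- g)"]) simp_all

text \<open>Up to index \<open>m\<close> the relators hold in \<open>G\<close> and so for
  translations; across the gap between \<open>m\<close> and \<open>Suc m\<close> the product is
  \<open>tri\<close>; beyond it neighbours are mutually inverse.\<close>

lemma respects_relators_amalgam_perm: "respects_relators (amalgam_perm m)"
proof -
  have tri: "bij tri" "tri ^^ 3 = id"
    by (simp_all add: tri_def bij_cycle3 cycle3_cubed)
  have bij: "bij (amalgam_perm m i)" for i
  proof (induction i)
    case (Suc i)
    consider "Suc i \<le> m" | "i = m" | "m < i" by linarith
    then show ?case
      by cases (simp_all add: amalgam_perm_le amalgam_perm_Suc amalgam_perm_gt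
          Suc.IH bij_translation bij_comp tri(1) bij_imp_bij_inv del: comp_apply)
  qed (simp add: amalgam_perm_le bij_translation)
  have "(amalgam_perm m (Suc i) \<circ> amalgam_perm m i) ^^ 3 = id" for i
  proof -
    consider "Suc i \<le> m" | "i = m" | "m < i" by linarith
    then show ?thesis
    proof cases
      case 1
      then show ?thesis using G_gen_relation[of "Suc (Suc i)"]
        by (simp add: amalgam_perm_le numeral_3_eq_3 add.assoc)
    next
      case 2
      then have "amalgam_perm m (Suc i) \<circ> amalgam_perm m i = tri"
        by (simp add: amalgam_perm_le amalgam_perm_Suc comp_assoc)
      then show ?thesis by (simp add: tri(2))
    next
      case 3
      then show ?thesis using bij[of i] by (simp add: amalgam_perm_gt bij_is_inj)
    qed
  qed
  with bij show ?thesis by (simp add: respects_relators_def)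
qed

text \<open>Stands in for the subgroup generated by the generators 1 to \<open>m + 1\<close>: only
  closure and membership of these generators are established.\<close>

definition translators :: "nat \<Rightarrow> G set" where
  "translators m = {g. G_act (amalgam_perm m) g = translation g}"

lemma zero_in_translators: "0 \<in> translators m"
  by (simp add: translators_def)

lemma add_in_translators:
  "x \<in> translators m \<Longrightarrow> y \<in> translators m \<Longrightarrow> x + y \<in> translators m"
  by (simp add: translators_def)

lemma uminus_in_translators:
  assumes "x \<in> translators m"
  shows "- x \<in> translators m"
proof -
  have "G_act (amalgam_perm m) (- x) \<circ> translation x = id"
    using assms G_act_add[of "amalgam_perm m" "- x" x] by (simp add: translators_def)
  then have "(G_act (amalgam_perm m) (- x) \<circ> translation x) \<circ> translation (- x) = translation (- x)"
    by simp
  then show ?thesis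
    by (simp only: comp_assoc translation_comp) (simp add: translators_def)
qed

lemma gen_in_translators: "1 \<le> i \<Longrightarrow> i \<le> Suc m \<Longrightarrow> G_gen i \<in> translators m"
  by (simp add: translators_def G_act_gen[OF respects_relators_amalgam_perm] amalgam_perm_le)

lemma conj_gen_translator_eq_zero:
  assumes u: "u \<in> translators m" and v: "v \<in> translators m"
    and eq: "G_gen (Suc (Suc m)) + u - G_gen (Suc (Suc m)) = v"
  shows "u = 0"
proof (rule ccontr)
  assume "u \<noteq> 0"
  let ?f = "G_gen (Suc m)" and ?act = "G_act (amalgam_perm m)"
  have act_f: "?act (G_gen (Suc (Suc m))) = tri \<circ> translation (- ?f)"
    by (simp add: G_act_gen[OF respects_relators_amalgam_perm] amalgam_perm_Suc)
  have "v + G_gen (Suc (Suc m)) = G_gen (Suc (Suc m)) + u"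
    using eq by auto
  then have "?act v \<circ> ?act (G_gen (Suc (Suc m))) = ?act (G_gen (Suc (Suc m))) \<circ> ?act u"
    by (simp only: flip: G_act_add)
  \<comment> \<open>On the left \<open>Inl ?f\<close> goes to \<open>Inl 0\<close>, then to
    \<open>Inr False\<close>, which \<open>v\<close> fixes. On the right a nonzero conjugate of
    \<open>u\<close> yields a point of \<open>Inl\<close> other than \<open>Inl 0\<close>, which
    \<open>tri\<close> fixes.\<close>
  then have "translation v (tri (translation (- ?f) (Inl ?f))) = tri (translation (- ?f) (translation u (Inl ?f)))"
    using u v by (simp add: translators_def act_f fun_eq_iff)
  moreover have "- ?f + (u + ?f) \<noteq> 0"
    using \<open>u \<noteq> 0\<close> by (metis add.assoc add_left_cancel add.right_neutral add_right_cancel add_0 right_minus)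
  ultimately show False
    by (simp add: translation_def tri_def cycle3_def)
qed


section \<open>Coefficients in the group algebra\<close>

lemma lookup_single_mult:
  fixes a :: "'g::group_add \<Rightarrow>\<^sub>0 'b::semiring_0"
  shows "Poly_Mapping.lookup (Poly_Mapping.single g c * a) x = c * Poly_Mapping.lookup a (- g + x)"
proof -
  have "x = g + q \<longleftrightarrow> q = - g + x" for q
    by (auto simp: add.assoc[symmetric])
  then show ?thesis
    by (simp add: lookup_mult lookup_single mult_when when_mult)
qed

lemma lookup_mult_single:
  fixes a :: "'g::group_add \<Rightarrow>\<^sub>0 'b::semiring_0"
  shows "Poly_Mapping.lookup (a * Poly_Mapping.single g c) x = Poly_Mapping.lookup a (x - g) * c"
proof -
  have "x = q + g \<longleftrightarrow> q = x - g" for q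
    by (auto simp: algebra_simps)
  then have "(c when g = r when x = q + r) = ((c when q = x - g) when r = g)" for q r
    by (auto simp: when_def)
  then show ?thesis
    by (simp add: lookup_mult lookup_single mult_when when_mult)
qed

lemma expec_add [simp]: "expec (a + b) = expec a + expec b"
  by (simp add: expec_def lookup_add)

text \<open>The coefficient of the product at \<open>0\<close> sums terms indexed by
  \<open>u\<close> and \<open>- u\<close>; only \<open>u = 0\<close> survives.\<close>

lemma expec_mult:
  assumes "\<And>u. u \<in> Poly_Mapping.keys a \<Longrightarrow> - u \<in> Poly_Mapping.keys b \<Longrightarrow> u = 0"
  shows "expec (a * b) = expec a * expec b"
proof -
  have eq: "0 = l + q \<longleftrightarrow> q = - l" for l q :: 'a
    by (metis add.inverse_unique right_minus)
  have "expec (a * b) = Sum_any (\<lambda>l. Poly_Mapping.lookup a l * Poly_Mapping.lookup b (- l))"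
    by (simp add: expec_def lookup_mult eq)
  also have "\<dots> = Sum_any (\<lambda>l :: 'a. (Poly_Mapping.lookup a 0 * Poly_Mapping.lookup b 0) when l = 0)"
    by (rule Sum_any.cong) (use assms in \<open>auto simp: when_def in_keys_iff\<close>)
  finally show ?thesis by (simp add: expec_def)
qed

lemma keys_prod_list_subset:
  fixes S :: "'g::monoid_add set" and X :: "'i \<Rightarrow> 'g \<Rightarrow>\<^sub>0 'b::semiring_1"
  assumes "0 \<in> S" "\<And>x y. x \<in> S \<Longrightarrow> y \<in> S \<Longrightarrow> x + y \<in> S"
    and "\<And>i. i \<in> set is \<Longrightarrow> Poly_Mapping.keys (X i) \<subseteq> S"
  shows "Poly_Mapping.keys (prod_list (map X is)) \<subseteq> S"
  using assms(3)
proof (induction "is")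
  case Nil
  then show ?case using assms(1) by simp
next
  case (Cons i "is")
  then show ?case
    using keys_mult[of "X i" "prod_list (map X is)"] assms(2) by fastforce
qed

lemma keys_X_var: "Poly_Mapping.keys (X_var i) \<subseteq> {G_gen i, - G_gen i}"
  unfolding X_var_def using keys_add by fastforce

lemma keys_prod_X_var_isolated_kernel:
  assumes "k \<ge> 1" "set is \<subseteq> {1..} - {k}"
  shows "Poly_Mapping.keys (prod_list (map X_var is)) \<subseteq> isolated_kernel k"
proof (rule keys_prod_list_subset)
  fix i assume "i \<in> set is"
  then show "Poly_Mapping.keys (X_var i) \<subseteq> isolated_kernel k"
    using assms gen_in_isolated_kernel[of i k] keys_X_var[of i] by force
qed (auto simp: zero_in_isolated_kernel add_in_isolated_kernel)

lemma keys_prod_X_var_translators: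
  assumes "set is \<subseteq> {1..<Suc (Suc m)}"
  shows "Poly_Mapping.keys (prod_list (map X_var is)) \<subseteq> translators m"
proof (rule keys_prod_list_subset)
  fix i assume "i \<in> set is"
  then have "G_gen i \<in> translators m"
    using assms gen_in_translators[of i m] by auto
  then show "Poly_Mapping.keys (X_var i) \<subseteq> translators m"
    using uminus_in_translators keys_X_var[of i] by blast
qed (auto simp: zero_in_translators add_in_translators)


section \<open>Condition A\<close>

lemma expec_X_var:
  assumes "k \<ge> 1"
  shows "expec (X_var k) = 0"
  using gen_notin_isolated_kernel[of k] zero_in_isolated_kernel[of k]
  by (auto simp: X_var_def expec_def lookup_add lookup_single when_def)

lemma expec_X_var_mult:
  assumes "k \<ge> 1" "set is \<subseteq> {1..} - {k}"
  shows "expec (X_var k * prod_list (map X_var is)) = 0"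
proof -
  have "expec (X_var k * prod_list (map X_var is)) = expec (X_var k) * expec (prod_list (map X_var is))"
  proof (rule expec_mult)
    fix u assume "u \<in> Poly_Mapping.keys (X_var k)" "- u \<in> Poly_Mapping.keys (prod_list (map X_var is))"
    then have "u \<in> {G_gen k, - G_gen k}" "u \<in> isolated_kernel k"
      using keys_X_var keys_prod_X_var_isolated_kernel[OF assms] by (blast, force)
    then show "u = 0" using gen_notin_isolated_kernel[of k] by auto
  qed
  then show ?thesis using expec_X_var[OF assms(1)] by simp
qed

text \<open>Of the four terms, the two with opposite signs are conjugates of \<open>w\<close> and
  each give \<open>expec w\<close>; the other two read \<open>w\<close> outside the kernel.\<close>

lemma expec_X_var_sandwich:
  assumes w: "Poly_Mapping.keys w \<subseteq> isolated_kernel k"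
  shows "expec (X_var k * w * X_var k) = 2 * expec w"
proof -
  have "Poly_Mapping.lookup w (G_gen k + G_gen k) = 0" "Poly_Mapping.lookup w (- G_gen k - G_gen k) = 0"
    using w gen_notin_isolated_kernel[of k] by (auto simp: in_keys_iff subset_iff)
  then show ?thesis
    by (simp add: X_var_def expec_def distrib_left distrib_right lookup_add lookup_mult_single
        lookup_single_mult)
qed

lemma expec_X_var_square: "expec ((X_var k)\<^sup>2) = 2"
  using expec_X_var_sandwich[of 1 k] zero_in_isolated_kernel
  by (simp add: power2_eq_square expec_def lookup_one)

lemma keys_X_var_sandwich:
  assumes "x \<in> Poly_Mapping.keys (X_var k * w * X_var k)"
  obtains g h u where "x = g + u + h" "u \<in> Poly_Mapping.keys w"
    "g \<in> {G_gen k, - G_gen k}" "h \<in> {G_gen k, - G_gen k}"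
  using assms keys_mult[of "X_var k * w" "X_var k"] keys_mult[of "X_var k" w] keys_X_var[of k]
  by blast

lemma expec_X_var_pair:
  assumes "k \<ge> 2" "set is \<subseteq> {1..<k}" "set js \<subseteq> {1..<k}"
  shows "expec (X_var k * prod_list (map X_var is) * X_var k * prod_list (map X_var js)) =
    2 * expec (prod_list (map X_var is)) * expec (prod_list (map X_var js))"
proof -
  let ?v = "prod_list (map X_var is)" and ?w = "prod_list (map X_var js)"
  \<comment> \<open>With \<open>m = k - 2\<close>, \<open>translators m\<close> contains all
    generators with index below \<open>k\<close>.\<close>
  obtain m where k: "k = Suc (Suc m)"
    using assms(1) by (auto dest!: le_Suc_ex)
  have ker: "Poly_Mapping.keys ?v \<subseteq> isolated_kernel k" "Poly_Mapping.keys ?w \<subseteq> isolated_kernel k"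
    using assms by (intro keys_prod_X_var_isolated_kernel; force)+
  have trans: "Poly_Mapping.keys ?v \<subseteq> translators m" "Poly_Mapping.keys ?w \<subseteq> translators m"
    using assms k by (auto intro!: keys_prod_X_var_translators)
  have "expec (X_var k * ?v * X_var k * ?w) = expec (X_var k * ?v * X_var k) * expec ?w"
  proof (rule expec_mult)
    fix x assume "x \<in> Poly_Mapping.keys (X_var k * ?v * X_var k)" and x: "- x \<in> Poly_Mapping.keys ?w"
    then obtain g h u where ghu: "x = g + u + h" "u \<in> Poly_Mapping.keys ?v"
      "g \<in> {G_gen k, - G_gen k}" "h \<in> {G_gen k, - G_gen k}"
      by (elim keys_X_var_sandwich)
    have "- x \<in> translators m" using x trans(2) by blast
    then have x_trans: "x \<in> translators m" using uminus_in_translators[of "- x" m] by simp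
    have "x \<in> isolated_kernel k" using x ker(2) by force
    \<comment> \<open>The middle word \<open>u\<close> is invisible to the isolating action, so
      equal signs of \<open>g\<close> and \<open>h\<close> are excluded.\<close>
    then have "g + h \<in> isolated_kernel k"
      using ghu(1,2) ker(1) conj_in_isolated_kernel_iff by blast
    then consider "g = G_gen k" "h = - G_gen k" | "g = - G_gen k" "h = G_gen k"
      using ghu(3,4) gen_notin_isolated_kernel[of k] by auto
    then show "x = 0"
    proof cases
      case 1
      have "u \<in> translators m" "G_gen k + u - G_gen k = x"
        using trans(1) ghu(1,2) 1 by auto
      then have "u = 0"
        using conj_gen_translator_eq_zero[of u m x] x_trans unfolding k by blast
      then show ?thesis using ghu 1 by simp
    next
      case 2
      \<comment> \<open>The conjugation is inverted, so \<open>x\<close> and \<open>u\<close>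
        exchange roles.\<close>
      have "G_gen k + x - G_gen k = u"
        using ghu(1) 2 by (simp add: add.assoc[symmetric])
      moreover have "u \<in> translators m"
        using trans(1) ghu(2) by auto
      ultimately show ?thesis
        using conj_gen_translator_eq_zero[of x m u] x_trans unfolding k by blast
    qed
  qed
  then show ?thesis using expec_X_var_sandwich[OF ker(1)] by simp
qed

lemma condition_A_X_var: "condition_A X_var"
proof -
  \<comment> \<open>The second clause of Condition A is the pair formula with an empty first
    word.\<close>
  have "expec ((X_var k)\<^sup>2 * prod_list (map X_var is)) = 2 * expec (prod_list (map X_var is))"
    if "k \<ge> 2" "set is \<subseteq> {1..<k}" for k "is"
    using expec_X_var_pair[of k "[]" "is"] that by (simp add: power2_eq_square expec_def lookup_one)
  then show ?thesis
    by (simp add: condition_A_def expec_X_var expec_X_var_mult expec_X_var_pair expec_X_var_square)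
qed


section \<open>Failure of freeness\<close>

text \<open>Nonnegativity of all coefficients rules out cancellation, so one known term bounds a
  coefficient of a product from below.\<close>

definition dominates :: "(G \<Rightarrow>\<^sub>0 complex) \<Rightarrow> G \<Rightarrow> bool" where
  "dominates a x \<longleftrightarrow> (\<forall>g. 0 \<le> Re (Poly_Mapping.lookup a g)) \<and> 1 \<le> Re (Poly_Mapping.lookup a x)"

lemma dominates_one: "dominates 1 0"
  by (simp add: dominates_def lookup_one when_def)

lemma dominates_mult_X_var: "dominates a x \<Longrightarrow> dominates (a * X_var i) (x + G_gen i)"
  by (auto simp: dominates_def X_var_def distrib_left lookup_add lookup_mult_single add_nonneg_nonneg
      add_increasing2)

lemma not_free_sequence_X_var: "\<not> free_sequence X_var"
proof
  \<comment> \<open>Positions start at 1, so the factors spell 2, 1, 2, 1, 2, 1, the pattern of the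
    first relator.\<close>
  define k :: "nat \<Rightarrow> nat" where "k i = (if even i then 1 else 2)" for i
  assume "free_sequence X_var"
  then have "free_variables {1, 2} X_var"
    unfolding free_sequence_def by (elim allE[of _ "{1, 2}"]) auto
  moreover have "X_var i \<in> subalgebra hull {1, X_var i, adj (X_var i)}" for i
    by (rule hull_inc) simp
  ultimately have "expec (prod_list (map (\<lambda>i. X_var (k i)) [1..<6 + 1])) = 0"
    unfolding free_variables_def free_subalgebras_def
    by (elim allE[of _ 6] impE allE[of _ k] allE[of _ "\<lambda>i. X_var (k i)"])
      (auto simp: k_def expec_X_var)
  moreover have "[1..<6 + 1] = [1, 2, 3, 4, 5, 6 :: nat]"
    by (simp add: upt_rec)
  \<comment> \<open>The leading \<open>1\<close> lets the product be built from
    \<open>dominates_one\<close> by multiplication on the right.\<close>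
  ultimately have "expec (1 * X_var 2 * X_var 1 * X_var 2 * X_var 1 * X_var 2 * X_var 1) = 0"
    by (simp add: k_def mult.assoc)
  moreover have "dominates (1 * X_var 2 * X_var 1 * X_var 2 * X_var 1 * X_var 2 * X_var 1)
      (0 + G_gen 2 + G_gen 1 + G_gen 2 + G_gen 1 + G_gen 2 + G_gen 1)"
    by (intro dominates_mult_X_var dominates_one)
  ultimately show False
    using G_gen_relation[of 2] by (simp add: dominates_def expec_def)
qed

theorem proposition9:
  shows "\<not> free_sequence X_var \<and> condition_A X_var"
  using not_free_sequence_X_var condition_A_X_var by blast

end
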